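(* For every integer $n\ge0$ and every real $x$, $$(\mathfrak{E}(x))_n=\frac{n!}{2^n}\sum_{k=0}^{n}\frac{(x-1)_k}{k!}\,2^k.$$
   Context: $(a)_n=a(a+1)\cdots(a+n-1)$ (with $(a)_0=1$) is the Pochhammer symbol (rising factorial). The Euler polynomials $E_n(x)$ are defined by $\frac{2e^{zx}}{e^z+1}=\sum_{n\ge0}E_n(x)\frac{z^n}{n!}$. The Euler umbra $\mathfrak{E}(x)$ is the evaluation rule $\mathfrak{E}(x)^k:=E_k(x)$ extended linearly to polynomials: if $(u)_n=\sum_k c_k u^k$, then $(\mathfrak{E}(x))_n=\sum_k c_k E_k(x)$. Equivalently $(\mathfrak{E}(x))_n$ is the expectation of $(x-\frac12+\imath L_E)_n$, where $\imath$ is the imaginary unit and $L_E$ is a real random variable with density $\operatorname{sech}(\pi u)$. *)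

theory Defs
  imports
    "HOL-Analysis.Analysis"
    "HOL-Computational_Algebra.Computational_Algebra"
begin

(* The quotient is taken in the ring of formal power series in z over the reals,
   where exp z + 1 is a unit (its constant term is 2); fps_exp c is exp (c z). *)
definition euler_gf :: "real \<Rightarrow> real fps" where
  "euler_gf x = 2 * fps_exp x / (fps_exp 1 + 1)"

definition euler_poly :: "nat \<Rightarrow> real \<Rightarrow> real" where
  "euler_poly n x = fact n * fps_nth (euler_gf x) n"

(* The linear extension of the rule u ^ k |-> E_k(x) to polynomials in u. *)
definition euler_umbra :: "real \<Rightarrow> real poly \<Rightarrow> real" where
  "euler_umbra x p = (\<Sum>k\<le>degree p. coeff p k * euler_poly k x)"

lemma euler_gf_eq: "euler_gf x * (fps_exp 1 + 1) = 2 * fps_exp x"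
  unfolding euler_gf_def by (rule dvd_div_mult_self) (simp add: unit_imp_dvd)

lemma euler_umbra_monom: "euler_umbra x (monom 1 k) = euler_poly k x"
  by (simp add: euler_umbra_def degree_monom_eq if_distrib[of "\<lambda>c. c * _"] cong: if_cong)

(* (u)_n as a polynomial in the indeterminate u = [:0, 1:]. *)
definition pochhammer_poly :: "nat \<Rightarrow> real poly" where
  "pochhammer_poly n = pochhammer [:0, 1:] n"

end

theory Submission
  imports Defs
begin

text \<open>
  Write $L_x(p)$ for \<open>euler_umbra x p\<close>. It satisfies the averaging identity
  $L_x(p(u+1)) + L_x(p(u)) = 2 p(x)$ for every polynomial \<open>p\<close>
  (lemma \<open>euler_umbra_shift\<close>): on monomials it is the coefficient form of the
  defining equation of the generating function. Apply it to $p(u) = (u-1)_n$.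
  Since $(u)_n - (u-1)_n = n (u)_{n-1}$, the numbers $a_n = L_x((u)_n)$ obey
  the recurrence $a_n = (n/2) a_{n-1} + (x-1)_n$ for $n \<ge> 1$, with $a_0 = E_0(x) = 1$
  (lemma \<open>euler_umbra_pochhammer_Suc\<close>), and the right-hand side of the theorem
  obeys the same recurrence.
\<close>

lemma euler_umbra_eq_sum:
  assumes "degree p \<le> N"
  shows "euler_umbra x p = (\<Sum>k\<le>N. coeff p k * euler_poly k x)"
  unfolding euler_umbra_def
  by (rule sum.mono_neutral_left) (use assms in \<open>auto simp: coeff_eq_0\<close>)

lemma euler_umbra_add: "euler_umbra x (p + q) = euler_umbra x p + euler_umbra x q"
proof -
  let ?N = "max (degree p) (degree q)"
  have "degree (p + q) \<le> ?N"
    by (rule degree_add_le_max)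
  then show ?thesis
    by (simp add: euler_umbra_eq_sum[of _ ?N] sum.distrib algebra_simps)
qed

lemma euler_umbra_smult: "euler_umbra x (smult c p) = c * euler_umbra x p"
  by (simp add: euler_umbra_eq_sum[of _ "degree p"] degree_smult_le sum_distrib_left mult.assoc)

lemma euler_umbra_0: "euler_umbra x 0 = 0"
  by (simp add: euler_umbra_def)

lemma euler_umbra_diff: "euler_umbra x (p - q) = euler_umbra x p - euler_umbra x q"
  using euler_umbra_add[of x "p - q" q] by simp

lemma euler_umbra_sum: "euler_umbra x (\<Sum>i\<in>A. f i) = (\<Sum>i\<in>A. euler_umbra x (f i))"
  by (induction A rule: infinite_finite_induct) (simp_all add: euler_umbra_0 euler_umbra_add)

text \<open>The classical relation $E_n(x+1) + E_n(x) = 2 x^n$, with $E_n(x+1)$ expanded in the $E_i(x)$.\<close>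

lemma euler_poly_binomial:
  "(\<Sum>i\<le>n. of_nat (n choose i) * euler_poly i x) + euler_poly n x = 2 * x ^ n"
proof -
  have rhs: "fps_nth (2 * fps_exp x) n = 2 * (x ^ n / fact n)"
    by (simp only: numeral_fps_const fps_mult_left_const_nth fps_exp_nth of_nat_fact)
  have "fps_nth (euler_gf x * fps_exp 1 + euler_gf x) n = fps_nth (2 * fps_exp x) n"
    using euler_gf_eq[of x] by (simp add: distrib_left)
  then have "(\<Sum>i\<le>n. fps_nth (euler_gf x) i / fact (n - i)) + fps_nth (euler_gf x) n
      = 2 * (x ^ n / fact n)"
    by (simp add: fps_mult_nth[of "euler_gf x"] atLeast0AtMost rhs)
  then have "fact n * ((\<Sum>i\<le>n. fps_nth (euler_gf x) i / fact (n - i)) + fps_nth (euler_gf x) n)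
      = 2 * x ^ n"
    by simp
  then show ?thesis
    by (simp add: euler_poly_def binomial_fact distrib_left sum_distrib_left)
qed

lemma linear_power_eq_sum_monom:
  "[:1, 1:] ^ n = (\<Sum>i\<le>n. smult (of_nat (n choose i)) (monom (1::real) i))"
proof (rule poly_eqI)
  fix k
  show "coeff ([:1, 1:] ^ n) k
      = coeff (\<Sum>i\<le>n. smult (of_nat (n choose i)) (monom (1::real) i)) k"
    by (cases "k \<le> n")
      (simp_all add: coeff_linear_poly_power coeff_sum if_distrib coeff_eq_0 degree_linear_power
        cong: if_cong)
qed

lemma pcompose_power: "pcompose (p ^ n) q = pcompose p q ^ n" for p q :: "'a::comm_ring_1 poly"
  by (induction n) (simp_all add: pcompose_1 pcompose_mult)

lemma pcompose_X_left: "pcompose [:0, 1:] q = q" for q :: "'a::comm_ring_1 poly"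
  by (simp add: pcompose_pCons)

lemma euler_umbra_shift:
  "euler_umbra x (pcompose p [:1, 1:]) + euler_umbra x p = 2 * poly p x"
proof -
  have monom: "euler_umbra x ([:1, 1:] ^ i) + euler_poly i x = 2 * x ^ i" for i
    using euler_poly_binomial[of i x]
    by (simp add: linear_power_eq_sum_monom euler_umbra_sum euler_umbra_smult euler_umbra_monom)
  have "pcompose p [:1, 1:] = pcompose (\<Sum>i\<le>degree p. smult (coeff p i) ([:0, 1:] ^ i)) [:1, 1:]"
    by (simp add: monom_altdef[symmetric] smult_monom poly_as_sum_of_monoms)
  also have "\<dots> = (\<Sum>i\<le>degree p. smult (coeff p i) ([:1, 1:] ^ i))"
    by (simp only: pcompose_sum pcompose_smult pcompose_power pcompose_X_left)
  finally have "euler_umbra x (pcompose p [:1, 1:]) + euler_umbra x p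
      = (\<Sum>i\<le>degree p. coeff p i * (euler_umbra x ([:1, 1:] ^ i) + euler_poly i x))"
    by (simp add: euler_umbra_sum euler_umbra_smult distrib_left sum.distrib
        euler_umbra_def[of x p])
  also have "\<dots> = 2 * poly p x"
    by (simp add: monom poly_altdef sum_distrib_left mult_ac)
  finally show ?thesis .
qed

lemma pcompose_pochhammer:
  "pcompose (pochhammer p n) q = pochhammer (pcompose p q) n" for p q :: "'a::comm_ring_1 poly"
  by (induction n) (simp_all add: pochhammer_Suc pcompose_1 pcompose_mult pcompose_add of_nat_poly)

lemma poly_pochhammer: "poly (pochhammer p n) x = pochhammer (poly p x) n"
  for x :: "'a::comm_ring_1"
  by (induction n) (simp_all add: pochhammer_Suc)

lemma pochhammer_backward_difference:
  "pochhammer a (Suc n) - pochhammer (a - 1) (Suc n) = of_nat (Suc n) * pochhammer a n"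
  for a :: "'a::comm_ring_1"
  unfolding pochhammer_Suc[of a] pochhammer_rec[of "a - 1"] by (simp add: algebra_simps)

lemma euler_umbra_pochhammer_Suc:
  "euler_umbra x (pochhammer_poly (Suc n))
    = of_nat (Suc n) / 2 * euler_umbra x (pochhammer_poly n) + pochhammer (x - 1) (Suc n)"
proof -
  \<comment> \<open>\<open>?q\<close> is $(u-1)_{n+1}$; shifting it by one gives $(u)_{n+1}$.\<close>
  let ?q = "pochhammer [:-1, 1:] (Suc n) :: real poly"
  have "pcompose ?q [:1, 1:] = pochhammer_poly (Suc n)"
    by (simp add: pcompose_pochhammer pochhammer_poly_def pcompose_pCons)
  then have shift: "euler_umbra x (pochhammer_poly (Suc n)) + euler_umbra x ?q
      = 2 * pochhammer (x - 1) (Suc n)"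
    using euler_umbra_shift[of x ?q] by (simp add: poly_pochhammer)
  have "?q = pochhammer ([:0, 1:] - 1) (Suc n)"
    by (simp add: one_pCons)
  then have "pochhammer_poly (Suc n) - ?q = smult (of_nat (Suc n)) (pochhammer_poly n)"
    using pochhammer_backward_difference[of "[:0, 1:] :: real poly" n]
    by (simp only: pochhammer_poly_def of_nat_poly) simp
  then have "euler_umbra x (pochhammer_poly (Suc n)) - euler_umbra x ?q
      = of_nat (Suc n) * euler_umbra x (pochhammer_poly n)"
    by (metis euler_umbra_diff euler_umbra_smult)
  with shift show ?thesis
    by (simp add: field_simps)
qed

theorem mainTheorem8:
  fixes n :: nat and x :: real
  shows "euler_umbra x (pochhammer_poly n) =
    fact n / 2 ^ n * (\<Sum>k=0..n. pochhammer (x - 1) k / fact k * 2 ^ k)"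
proof (induction n)
  case 0
  have "euler_umbra x (pochhammer_poly 0) = euler_poly 0 x"
    by (simp add: pochhammer_poly_def euler_umbra_def)
  \<comment> \<open>For $n = 0$ the binomial relation reads $2 E_0(x) = 2$.\<close>
  then show ?case
    using euler_poly_binomial[of 0 x] by simp
next
  case (Suc n)
  let ?S = "\<Sum>k=0..n. pochhammer (x - 1) k / fact k * 2 ^ k"
  have "euler_umbra x (pochhammer_poly (Suc n))
      = of_nat (Suc n) / 2 * (fact n / 2 ^ n * ?S) + pochhammer (x - 1) (Suc n)"
    by (simp only: euler_umbra_pochhammer_Suc Suc.IH)
  also have "of_nat (Suc n) / 2 * (fact n / 2 ^ n * ?S) = fact (Suc n) / 2 ^ Suc n * ?S"
    by simp
  also have "pochhammer (x - 1) (Suc n)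
      = fact (Suc n) / 2 ^ Suc n * (pochhammer (x - 1) (Suc n) / fact (Suc n) * 2 ^ Suc n)"
    by (simp del: fact_Suc)
  finally show ?case
    by (simp only: sum.atLeast0_atMost_Suc distrib_left)
qed

end
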